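(* Let $m\ge 1$ be an integer, let $S=\{1,\dots,m\}$, and let $\varepsilon:S\times S\to\{\pm1\}$ be any symmetric function. Then there exist an integer $n\le 2m$ and a map $\sigma:S\to\mathbb{Z}_2^n$, $i\mapsto\sigma_i$, such that for all $i,j\in S$ $$\varepsilon(i,j)=(-1)^{\langle\sigma_i,\sigma_j\rangle_n}.$$
   Context: $\mathbb{Z}_2=\mathbb{Z}/2\mathbb{Z}=\{0,1\}$. For $i=(i_1,\dots,i_n)$ and $j=(j_1,\dots,j_n)$ in $\mathbb{Z}_2^n$, the standard `scalar product' is $\langle i,j\rangle_n=i_1j_1+\dots+i_nj_n$ (only its value modulo 2 matters). The function $\varepsilon$ is thought of as a sign rule $y^iy^j=\varepsilon(i,j)\,y^jy^i$ for an associative algebra generated by $y^1,\dots,y^m$. *)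

theory Defs
  imports Main "HOL-Library.Z2" "HOL-Library.FuncSet"
begin

text \<open>Vectors have coordinates indexed by \<open>{1..n}\<close>; being extensional, they are
  determined by these coordinates, so the set has exactly \<open>2 ^ n\<close> elements.\<close>

definition Z2_vectors :: "nat \<Rightarrow> (nat \<Rightarrow> bit) set" where
  "Z2_vectors n = {1..n} \<rightarrow>\<^sub>E (UNIV :: bit set)"

text \<open>The representatives \<open>0\<close> and \<open>1\<close> of the coordinates are multiplied and added as natural
  numbers, so that the product can serve as an exponent of \<open>-1\<close>.\<close>

definition scalar_prod :: "nat \<Rightarrow> (nat \<Rightarrow> bit) \<Rightarrow> (nat \<Rightarrow> bit) \<Rightarrow> nat" where
  "scalar_prod n x y = (\<Sum>k = 1..n. of_bit (x k) * of_bit (y k))"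

end

theory Submission
  imports Defs
begin

text \<open>Writing \<open>\<epsilon> i j = (-1) ^ a i j\<close>, the claim is that the symmetric matrix \<open>a\<close> over the field
  with two elements is a Gram matrix. Let \<open>c\<close> be the last column of \<open>a\<close> with its diagonal entry replaced by
  \<open>1\<close>. Then \<open>a + c c\<^sup>T\<close> vanishes outside its leading block of size \<open>m - 1\<close>, except possibly for the
  last diagonal entry. So two new coordinates suffice in the induction step: one for \<open>c\<close> and one
  for that diagonal entry.\<close>

lemma symmetric_bit_matrix_Gram:
  fixes a :: "nat \<Rightarrow> nat \<Rightarrow> bit"
  assumes "\<forall>i\<in>{1..m}. \<forall>j\<in>{1..m}. a i j = a j i"
  shows "\<exists>s :: nat \<Rightarrow> nat \<Rightarrow> bit. \<forall>i\<in>{1..m}. \<forall>j\<in>{1..m}. (\<Sum>k = 1..2 * m. s i k * s j k) = a i j"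
  using assms
proof (induction m arbitrary: a)
  case 0
  then show ?case by simp
next
  case (Suc m)
  \<comment> \<open>The diagonal entry stays in \<open>c\<close>; its replacement by 1 takes place
    inside \<open>t\<close>.\<close>
  define c where "c i = a i (Suc m)" for i
  have "\<forall>i\<in>{1..m}. \<forall>j\<in>{1..m}. a i j + c i * c j = a j i + c j * c i"
    using Suc.prems by auto
  from Suc.IH[OF this] obtain s :: "nat \<Rightarrow> nat \<Rightarrow> bit"
    where s: "\<And>i j. i \<in> {1..m} \<Longrightarrow> j \<in> {1..m} \<Longrightarrow> (\<Sum>k = 1..2 * m. s i k * s j k) = a i j + c i * c j"
    by blast
  \<comment> \<open>The row \<open>Suc m\<close> vanishes on the old coordinates, so its products
    with the other rows come from coordinate \<open>Suc (2 * m)\<close> alone. The last coordinate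
    is nonzero at most in that row and only corrects its square.\<close>
  define t where "t i k =
    (if k \<le> 2 * m then if i \<le> m then s i k else 0
     else if k = Suc (2 * m) then if i \<le> m then c i else 1
     else if i \<le> m then 0 else c i + 1)" for i k
  have split: "(\<Sum>k = 1..2 * Suc m. t i k * t j k) =
      (\<Sum>k = 1..2 * m. t i k * t j k) + t i (Suc (2 * m)) * t j (Suc (2 * m))
        + t i (Suc (Suc (2 * m))) * t j (Suc (Suc (2 * m)))" for i j
    by simp
  have block: "(\<Sum>k = 1..2 * m. t i k * t j k) =
      (if i \<le> m \<and> j \<le> m then \<Sum>k = 1..2 * m. s i k * s j k else 0)" for i j
    by (auto simp: t_def intro!: sum.cong sum.neutral)
  have "(\<Sum>k = 1..2 * Suc m. t i k * t j k) = a i j"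
    if i: "i \<in> {1..Suc m}" and j: "j \<in> {1..Suc m}" for i j
  proof -
    have sym: "a (Suc m) j = c j"
      using Suc.prems j by (simp add: c_def)
    consider "i \<in> {1..m}" "j \<in> {1..m}" | "i \<in> {1..m}" "j = Suc m"
      | "i = Suc m" "j \<in> {1..m}" | "i = Suc m" "j = Suc m"
      using i j by fastforce
    then show ?thesis
    proof cases
      \<comment> \<open>The two copies of \<open>c i * c j\<close> cancel in characteristic
        2.\<close>
      case 1
      then show ?thesis
        unfolding split block using s[of i j] by (auto simp: t_def)
    next
      case 2
      then show ?thesis
        unfolding split block by (simp add: t_def c_def)
    next
      case 3
      then show ?thesis
        unfolding split block using sym by (simp add: t_def)
    next
      \<comment> \<open>With \<open>x = a (Suc m) (Suc m)\<close> the sum is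
        \<open>1 + (x + 1)^2 = x\<close>, since every bit is its own square.\<close>
      case 4
      then show ?thesis
        unfolding split block by (cases "a (Suc m) (Suc m)") (simp_all add: t_def c_def)
    qed
  qed
  then show ?case by blast
qed

text \<open>Reduction modulo 2 respects sums and products; this turns the exponent into a Gram
  entry.\<close>

lemma of_nat_scalar_prod:
  "(of_nat (scalar_prod n x y) :: bit) = (\<Sum>k = 1..n. x k * y k)"
proof -
  have "(of_nat (of_bit (x k) * of_bit (y k)) :: bit) = x k * y k" for k
    by (cases "x k"; cases "y k") simp_all
  then show ?thesis
    unfolding scalar_prod_def of_nat_sum by (rule sum.cong[OF refl])
qed

lemma scalar_prod_restrict:
  "scalar_prod n (restrict x {1..n}) (restrict y {1..n}) = scalar_prod n x y"
  by (simp add: scalar_prod_def)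

text \<open>\<open>of_nat\<close> into \<open>bit\<close> is parity, and a power of -1 depends on
  nothing else.\<close>

lemma minus_one_power_eq_if_bit:
  "(-1 :: int) ^ n = (if (of_nat n :: bit) = 0 then 1 else -1)"
  by (induction n) auto

theorem theorem2p1:
  fixes m :: nat and \<epsilon> :: "nat \<Rightarrow> nat \<Rightarrow> int"
  assumes "m \<ge> 1"
    and "\<forall>i\<in>{1..m}. \<forall>j\<in>{1..m}. \<epsilon> i j \<in> {1, -1}"
    and "\<forall>i\<in>{1..m}. \<forall>j\<in>{1..m}. \<epsilon> i j = \<epsilon> j i"
  shows "\<exists>(n::nat) (\<sigma> :: nat \<Rightarrow> nat \<Rightarrow> bit). n \<le> 2 * m \<and> \<sigma> \<in> {1..m} \<rightarrow> Z2_vectors n \<and>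
    (\<forall>i\<in>{1..m}. \<forall>j\<in>{1..m}. \<epsilon> i j = (-1) ^ scalar_prod n (\<sigma> i) (\<sigma> j))"
proof -
  define a :: "nat \<Rightarrow> nat \<Rightarrow> bit" where "a i j = (if \<epsilon> i j = 1 then 0 else 1)" for i j
  have "\<forall>i\<in>{1..m}. \<forall>j\<in>{1..m}. a i j = a j i"
    using assms(3) by (simp add: a_def)
  from symmetric_bit_matrix_Gram[OF this] obtain s :: "nat \<Rightarrow> nat \<Rightarrow> bit"
    where s: "\<And>i j. i \<in> {1..m} \<Longrightarrow> j \<in> {1..m} \<Longrightarrow> (\<Sum>k = 1..2 * m. s i k * s j k) = a i j"
    by blast
  \<comment> \<open>Restriction gives the extensionality that \<open>Z2_vectors\<close> demands and
    changes no scalar product.\<close>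
  define \<sigma> where "\<sigma> i = restrict (s i) {1..2 * m}" for i
  have "\<sigma> \<in> {1..m} \<rightarrow> Z2_vectors (2 * m)"
    by (auto simp: \<sigma>_def Z2_vectors_def)
  moreover have "\<epsilon> i j = (-1) ^ scalar_prod (2 * m) (\<sigma> i) (\<sigma> j)"
    if "i \<in> {1..m}" "j \<in> {1..m}" for i j
  proof -
    have "\<epsilon> i j \<in> {1, -1}"
      using assms(2) that by blast
    then show ?thesis
      unfolding minus_one_power_eq_if_bit \<sigma>_def scalar_prod_restrict of_nat_scalar_prod s[OF that]
      by (auto simp: a_def)
  qed
  ultimately show ?thesis
    by blast
qed

end
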